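(* Let $p\in[1,\infty)$. Suppose that for any $\epsilon >0$ there is a constant $C_\epsilon<\infty$ such that \[ \left\lVert \sum_{T \in \mathbb{T} } \chi_T \right\rVert_{L^p(B(0,1))} ^p \leq C_{\epsilon}\, \delta^{-\epsilon} \] for every $\delta\in(0,1)$ and any family $\mathbb{T}$ of $1 \times \delta \times \delta$ $SL_2$ tubes with $\delta$-separated directions. Then $p \leq 3/2$.
   Context: A line $\ell \subseteq \mathbb{R}^3$ is called an $SL_2$ line if either there exist $a,b,c,d \in \mathbb{R}$ with $ad-bc = 1$ such that $\ell = \{(a,b,0) + \lambda (c,d,1) : \lambda \in \mathbb{R} \}$, or there exist $t_0 \in \mathbb{R}$ and $(c,d) \in \mathbb{R}^2 \setminus \{0\}$ such that $\ell = \{(0,0,t_0) + \lambda (c,d,0) : \lambda \in \mathbb{R} \}$. A $1\times\delta\times\delta$ tube in $\mathbb{R}^3$ is a solid cylinder of length $1$ and radius $\delta$; it is an $SL_2$ tube if its centre line is an $SL_2$ line, and its direction is the direction in $S^2$ of its centre line. $B(0,1)$ is the unit ball in $\mathbb{R}^3$, and $\chi_T$ is the indicator function of $T$. *)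

theory Defs
  imports "HOL-Analysis.Analysis"
begin

definition SL2_line :: "(real^3) set \<Rightarrow> bool" where
  "SL2_line l \<longleftrightarrow>
     (\<exists>a b c d. a * d - b * c = 1 \<and>
        l = {vector [a, b, 0] + t *\<^sub>R vector [c, d, 1] | t. True}) \<or>
     (\<exists>t0 c d. (c, d) \<noteq> (0, 0) \<and>
        l = {vector [0, 0, t0] + t *\<^sub>R vector [c, d, 0] | t. True})"

text \<open>The closed solid cylinder of length 1 and radius \<open>r\<close> with centre \<open>x\<close> and (unit) axis
  vector \<open>u\<close>.\<close>

definition cylinder :: "real \<Rightarrow> real^3 \<Rightarrow> real^3 \<Rightarrow> (real^3) set" where
  "cylinder r x u =
     {x + s *\<^sub>R u + w | s w. \<bar>s\<bar> \<le> 1/2 \<and> w \<bullet> u = 0 \<and> norm w \<le> r}"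

definition is_tube :: "real \<Rightarrow> (real^3) set \<Rightarrow> real^3 \<Rightarrow> (real^3) set \<Rightarrow> bool" where
  "is_tube \<delta> l u T \<longleftrightarrow>
     norm u = 1 \<and> (\<exists>x. l = {x + t *\<^sub>R u | t. True} \<and> T = cylinder \<delta> x u)"

definition SL2_tube :: "real \<Rightarrow> (real^3) set \<Rightarrow> bool" where
  "SL2_tube \<delta> T \<longleftrightarrow> (\<exists>l u. SL2_line l \<and> is_tube \<delta> l u T)"

text \<open>A tube determines its direction only up to sign, so \<open>tube_direction \<delta> T\<close> holds of two
  antipodal unit vectors.\<close>

definition tube_direction :: "real \<Rightarrow> (real^3) set \<Rightarrow> real^3 \<Rightarrow> bool" where
  "tube_direction \<delta> T u \<longleftrightarrow> (\<exists>l. is_tube \<delta> l u T)"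

text \<open>Separation is required for both choices of sign, that is, for directions as points of the
  sphere modulo the antipodal map.\<close>

definition separated_directions :: "real \<Rightarrow> (real^3) set set \<Rightarrow> bool" where
  "separated_directions \<delta> \<T> \<longleftrightarrow>
     (\<forall>T\<in>\<T>. \<forall>T'\<in>\<T>. T \<noteq> T' \<longrightarrow>
        (\<forall>u v. tube_direction \<delta> T u \<longrightarrow> tube_direction \<delta> T' v \<longrightarrow> \<delta> \<le> dist u v))"

text \<open>The families under consideration are automatically finite, so that the sum of their
  indicator functions is a genuine finite sum.\<close>

lemma finite_separated_SL2_tubes:
  assumes "0 < \<delta>" and tubes: "\<forall>T\<in>\<T>. SL2_tube \<delta> T" and sep: "separated_directions \<delta> \<T>"
  shows "finite \<T>"
proof -
  have "\<forall>T\<in>\<T>. \<exists>u. tube_direction \<delta> T u"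
    using tubes unfolding SL2_tube_def tube_direction_def by blast
  then obtain f where f: "\<And>T. T \<in> \<T> \<Longrightarrow> tube_direction \<delta> T (f T)" by metis
  have d: "\<delta> \<le> dist (f T) (f T')" if "T \<in> \<T>" "T' \<in> \<T>" "T \<noteq> T'" for T T'
    using sep that f unfolding separated_directions_def by blast
  then have inj: "inj_on f \<T>"
    using \<open>0 < \<delta>\<close> by (force intro!: inj_onI)
  have "norm (f T) = 1" if "T \<in> \<T>" for T
    using f[OF that] by (auto simp: tube_direction_def is_tube_def)
  then have b: "f ` \<T> \<subseteq> cball 0 1" by auto
  have "finite (f ` \<T>)"
  proof (rule ccontr)
    assume "infinite (f ` \<T>)"
    then obtain x where "x islimpt f ` \<T>"
      using b compact_cball Heine_Borel_imp_Bolzano_Weierstrass by blast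
    then have "infinite (f ` \<T> \<inter> ball x (\<delta>/2))"
      using \<open>0 < \<delta>\<close> by (simp add: islimpt_eq_infinite_ball)
    then obtain y z where yz: "y \<in> f ` \<T> \<inter> ball x (\<delta>/2)" "z \<in> f ` \<T> \<inter> ball x (\<delta>/2)" "y \<noteq> z"
      by (metis finite.simps infinite_imp_nonempty is_singletonI' is_singleton_def)
    then have "dist y z < \<delta>"
      by (auto intro: dist_triangle_half_r)
    moreover have "\<delta> \<le> dist y z" using yz d by auto
    ultimately show False by simp
  qed
  with inj show ?thesis by (simp add: finite_image_iff)
qed

text \<open>Only meaningful for \<open>f\<close> with \<open>\<bar>f\<bar>\<^sup>p\<close> integrable over \<open>A\<close>: the Bochner integral is 0
  otherwise. A finite sum of indicator functions of cylinders over a ball is of this kind.\<close>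

definition Lp_norm :: "real \<Rightarrow> 'a::euclidean_space set \<Rightarrow> ('a \<Rightarrow> real) \<Rightarrow> real" where
  "Lp_norm p A f = (LINT x:A|lebesgue. \<bar>f x\<bar> powr p) powr (1/p)"

end

theory Submission
  imports Defs
begin

text \<open>A hairbrush is a counterexample for \<open>p > 3/2\<close>. The line through \<open>(1/d, 0, 0)\<close> with direction
  \<open>(c, d, 1)\<close> is an \<open>SL\<^sub>2\<close> line meeting the \<open>x\<close>-axis, and when \<open>c\<close> and \<open>d\<close> run through a grid of
  spacing \<open>50 \<delta>\<close> in \<open>[-1, 1] \<times> [2, 4]\<close> this gives about \<open>\<delta>\<^sup>-\<^sup>2\<close> tubes with \<open>\<delta>\<close>-separated directions.
  Its point at height \<open>z\<close> is \<open>(x, y, z) = (1/d + z c, z d, z)\<close>, so \<open>x y = z + O(z\<^sup>2)\<close>. With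
  \<open>r = \<delta>\<^sup>1\<^sup>/\<^sup>2\<close>, the parts of the tubes within distance \<open>r\<close> of the axis, whose volumes add up to about \<open>r\<close>,
  therefore lie in a twisted plank of dimensions \<open>1 \<times> r \<times> r\<^sup>2\<close>. So the multiplicity is about \<open>r\<^sup>-\<^sup>2\<close>
  on a set of measure about \<open>r\<^sup>3\<close>, and the \<open>p\<close>-th power of the norm is at least about \<open>r\<^sup>3\<^sup>-\<^sup>2\<^sup>p\<close>.\<close>

section \<open>Cylinders and the uniqueness of their axes\<close>

lemma mem_cylinder_iff:
  assumes "norm u = 1"
  shows "y \<in> cylinder r x u \<longleftrightarrow>
    \<bar>(y - x) \<bullet> u\<bar> \<le> 1/2 \<and> norm (y - x - ((y - x) \<bullet> u) *\<^sub>R u) \<le> r"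
proof
  have uu: "u \<bullet> u = 1" using assms by (simp add: norm_eq_1)
  {
    assume "y \<in> cylinder r x u"
    then obtain s w where y: "y = x + s *\<^sub>R u + w" "\<bar>s\<bar> \<le> 1/2" "w \<bullet> u = 0" "norm w \<le> r"
      unfolding cylinder_def by blast
    then have "(y - x) \<bullet> u = s" using uu by (simp add: inner_add_left)
    with y show "\<bar>(y - x) \<bullet> u\<bar> \<le> 1/2 \<and> norm (y - x - ((y - x) \<bullet> u) *\<^sub>R u) \<le> r"
      by simp
  next
    assume *: "\<bar>(y - x) \<bullet> u\<bar> \<le> 1/2 \<and> norm (y - x - ((y - x) \<bullet> u) *\<^sub>R u) \<le> r"
    define w where "w = y - x - ((y - x) \<bullet> u) *\<^sub>R u"
    have "w \<bullet> u = 0" unfolding w_def using uu by (simp add: inner_diff_left)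
    moreover have "y = x + ((y - x) \<bullet> u) *\<^sub>R u + w" by (simp add: w_def)
    ultimately show "y \<in> cylinder r x u"
      unfolding cylinder_def using * w_def by blast
  }
qed

lemma closed_cylinder:
  assumes "norm u = 1"
  shows "closed (cylinder r x u)"
proof -
  have "cylinder r x u =
    {y. \<bar>(y - x) \<bullet> u\<bar> \<le> 1/2} \<inter> {y. norm (y - x - ((y - x) \<bullet> u) *\<^sub>R u) \<le> r}"
    using mem_cylinder_iff[OF assms] by auto
  moreover have "closed {y. \<bar>(y - x) \<bullet> u\<bar> \<le> 1/2}"
    by (intro closed_Collect_le continuous_intros)
  moreover have "closed {y. norm (y - x - ((y - x) \<bullet> u) *\<^sub>R u) \<le> r}"
    by (intro closed_Collect_le continuous_intros)
  ultimately show ?thesis by (simp add: closed_Int)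
qed

text \<open>The foot of the perpendicular is the point of the axis nearest to \<open>y\<close>, so
  closeness to any axis point bounds the radial part. The height is bounded by
  Cauchy-Schwarz.\<close>

lemma mem_cylinder_if_near_axis:
  assumes u: "norm u = 1" and "norm (y - x) \<le> 1/2" and "dist y (x + t *\<^sub>R u) \<le> r"
  shows "y \<in> cylinder r x u"
proof -
  define w where "w = y - x - ((y - x) \<bullet> u) *\<^sub>R u"
  define q where "q = y - (x + t *\<^sub>R u)"
  have uu: "u \<bullet> u = 1" using u by (simp add: norm_eq_1)
  have wu: "w \<bullet> u = 0" unfolding w_def using uu by (simp add: inner_diff_left)
  have "q = w + ((y - x) \<bullet> u - t) *\<^sub>R u"
    by (simp add: q_def w_def algebra_simps)
  then have "(norm q)\<^sup>2 = (norm w)\<^sup>2 + (norm (((y - x) \<bullet> u - t) *\<^sub>R u))\<^sup>2"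
    using wu by (simp add: norm_add_Pythagorean orthogonal_def)
  then have "(norm w)\<^sup>2 \<le> (norm q)\<^sup>2" by simp
  then have "norm w \<le> norm q" using power2_le_imp_le by force
  also have "\<dots> \<le> r" using assms(3) by (simp add: q_def dist_norm)
  finally have "norm w \<le> r" .
  moreover have "\<bar>(y - x) \<bullet> u\<bar> \<le> 1/2"
    using Cauchy_Schwarz_ineq2[of "y - x" u] u assms(2) by simp
  ultimately show ?thesis unfolding mem_cylinder_iff[OF u] w_def by simp
qed

text \<open>In every direction orthogonal to its axis the cylinder has width \<open>2 * r\<close>, which for
  \<open>r < 1/2\<close> is less than its width in a direction not orthogonal to the axis. Hence the orthogonal
  complement of the axis is determined by the point set.\<close>

lemma cylinder_axis_unique:
  assumes r: "0 \<le> r" "r < 1/2" and u: "norm u = 1" and v: "norm v = 1"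
    and eq: "cylinder r x u = cylinder r y v"
  shows "v = u \<or> v = - u"
proof -
  have uu: "u \<bullet> u = 1" and vv: "v \<bullet> v = 1" using u v by (simp_all add: norm_eq_1)
  define e where "e = v - (v \<bullet> u) *\<^sub>R u"
  have eu: "e \<bullet> u = 0" using uu by (simp add: e_def inner_diff_left)
  have "e = 0"
  proof (rule ccontr)
    assume "e \<noteq> 0"
    \<comment> \<open>\<open>f\<close> is orthogonal to \<open>u\<close> but not to
      \<open>v\<close>; the widths along \<open>f\<close> given by the two descriptions of the
      cylinder are compared.\<close>
    define f where "f = sgn e"
    have nf: "norm f = 1" using \<open>e \<noteq> 0\<close> by (simp add: f_def norm_sgn)
    have fu: "f \<bullet> u = 0" using eu by (simp add: f_def sgn_div_norm)
    define c where "c = v \<bullet> f"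
    have "v \<bullet> e = e \<bullet> e"
    proof -
      have "(v - e) \<bullet> e = 0" using eu by (simp add: e_def inner_commute)
      then show ?thesis by (simp add: inner_diff_left)
    qed
    then have c0: "c > 0" using \<open>e \<noteq> 0\<close> by (simp add: c_def f_def sgn_div_norm)
    have c1: "c \<le> 1" using norm_cauchy_schwarz[of v f] v nf by (simp add: c_def)
    define w where "w = f - c *\<^sub>R v"
    have wv: "w \<bullet> v = 0" using vv by (simp add: w_def inner_diff_left c_def inner_commute[of v f])
    have wf: "w \<bullet> f = (norm w)\<^sup>2"
    proof -
      have "f = w + c *\<^sub>R v" by (simp add: w_def)
      then have "w \<bullet> f = w \<bullet> (w + c *\<^sub>R v)" by simp
      then show ?thesis using wv by (simp add: inner_add_right power2_norm_eq_inner)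
    qed
    have nw: "1 - c \<le> norm w"
      using norm_triangle_ineq[of w "c *\<^sub>R v"] nf v c0 by (simp add: w_def)
    \<comment> \<open>\<open>w\<close> is the projection of \<open>f\<close> to the plane orthogonal
      to \<open>v\<close>, so \<open>g\<close> is a point furthest along \<open>f\<close> in the
      disc of radius \<open>r\<close> there. For \<open>w = 0\<close> it is 0, as
      \<open>sgn 0 = 0\<close>.\<close>
    define g where "g = r *\<^sub>R sgn w"
    have gv: "g \<bullet> v = 0" using wv by (simp add: g_def sgn_div_norm)
    have gf: "g \<bullet> f = r * norm w"
      using wf by (cases "w = 0") (simp_all add: g_def sgn_div_norm power2_eq_square)
    have ng: "norm g \<le> r" using r by (simp add: g_def norm_sgn)
    have cyl: "y + t *\<^sub>R v + w' \<in> cylinder r x u"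
      if "\<bar>t\<bar> \<le> 1/2" "w' \<bullet> v = 0" "norm w' \<le> r" for t w'
      unfolding eq unfolding cylinder_def using that by blast
    \<comment> \<open>Opposite points of the two end discs, \<open>c + 2 * r * norm w\<close> apart
      along \<open>f\<close>.\<close>
    have "y + (1/2) *\<^sub>R v + g \<in> cylinder r x u"
      using gv ng by (intro cyl) auto
    moreover have "y + (-1/2) *\<^sub>R v + (- g) \<in> cylinder r x u"
      using gv ng by (intro cyl) auto
    ultimately obtain s w1 s' w2 where
      1: "y + (1/2) *\<^sub>R v + g = x + s *\<^sub>R u + w1" "norm w1 \<le> r" and
      2: "y + (-1/2) *\<^sub>R v + (- g) = x + s' *\<^sub>R u + w2" "norm w2 \<le> r"
      unfolding cylinder_def by blast
    have "(y + (1/2) *\<^sub>R v + g) \<bullet> f - (y + (-1/2) *\<^sub>R v + (- g)) \<bullet> f = w1 \<bullet> f - w2 \<bullet> f"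
      unfolding 1(1) 2(1) using fu by (simp add: inner_add_left inner_commute[of u f])
    then have "c + 2 * r * norm w = w1 \<bullet> f - w2 \<bullet> f"
      using gf by (simp add: inner_add_left c_def inner_diff_left)
    also have "\<dots> \<le> 2 * r"
      using Cauchy_Schwarz_ineq2[of w1 f] Cauchy_Schwarz_ineq2[of w2 f] nf 1(2) 2(2) by auto
    finally have "c + 2 * r * norm w \<le> 2 * r" .
    \<comment> \<open>Inserting \<open>norm w \<ge> 1 - c\<close> leaves
      \<open>c * (1 - 2 * r) \<le> 0\<close>, which contradicts \<open>r < 1/2\<close>.\<close>
    moreover have "2 * r * (1 - c) \<le> 2 * r * norm w" using nw r by (intro mult_left_mono) auto
    ultimately have "c + 2 * r * (1 - c) \<le> 2 * r" by linarith
    then have "c * (1 - 2 * r) \<le> 0" by (simp add: algebra_simps)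
    then show False using c0 r by (simp add: mult_le_0_iff)
  qed
  then have "v = (v \<bullet> u) *\<^sub>R u" by (simp add: e_def)
  then have "\<bar>v \<bullet> u\<bar> = 1" using u v by (metis mult.right_neutral norm_scaleR)
  then have "v \<bullet> u = 1 \<or> v \<bullet> u = - 1" by linarith
  then have "v = 1 *\<^sub>R u \<or> v = (- 1) *\<^sub>R u"
    using \<open>v = (v \<bullet> u) *\<^sub>R u\<close> by (elim disjE) simp_all
  then show ?thesis by simp
qed

section \<open>The hairbrush and the separation of its directions\<close>

text \<open>With \<open>b = 0\<close> the condition \<open>a * d - b * c = 1\<close> forces
  \<open>a = 1/d\<close>. The tube is centred where its line meets the x-axis.\<close>

definition brush_tube :: "real \<Rightarrow> real \<Rightarrow> real \<Rightarrow> (real^3) set" where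
  "brush_tube \<delta> c d = cylinder \<delta> (vector [1/d, 0, 0]) (sgn (vector [c, d, 1]))"

lemma vector_cd1_nz: "(vector [c, d, 1] :: real^3) \<noteq> 0"
  by (simp add: vec_eq_iff forall_3)

lemma norm_sgn_cd1: "norm (sgn (vector [c, d, 1] :: real^3)) = 1"
  using vector_cd1_nz by (simp add: norm_sgn)

lemma SL2_tube_brush:
  assumes "d \<noteq> 0"
  shows "SL2_tube \<delta> (brush_tube \<delta> c d)"
proof -
  define V :: "real^3" where "V = vector [c, d, 1]"
  define l :: "(real^3) set" where "l = {vector [1/d, 0, 0] + t *\<^sub>R V | t. True}"
  have V0: "norm V \<noteq> 0" using vector_cd1_nz by (simp add: V_def)
  have "SL2_line l"
    unfolding SL2_line_def l_def V_def using assms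
    by (intro disjI1 exI[of _ "1/d"] exI[of _ 0] exI[of _ c] exI[of _ d]) simp
  moreover have "l = {vector [1/d, 0, 0] + t *\<^sub>R sgn V | t. True}"
  proof -
    have "\<exists>t'. t *\<^sub>R V = t' *\<^sub>R sgn V" for t
      using V0 by (intro exI[of _ "t * norm V"]) (simp add: sgn_div_norm)
    moreover have "\<exists>t'. t *\<^sub>R sgn V = t' *\<^sub>R V" for t
      by (intro exI[of _ "t / norm V"]) (simp add: sgn_div_norm divide_inverse)
    ultimately show ?thesis unfolding l_def by (auto; metis)
  qed
  ultimately show ?thesis
    unfolding SL2_tube_def is_tube_def brush_tube_def
    using norm_sgn_cd1 V_def by metis
qed

text \<open>The tube fixes its axis vector only up to sign, but both equations are homogeneous in
  \<open>u\<close>, so neither the sign nor the normalisation affects them.\<close>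

lemma brush_tube_direction:
  assumes "0 < \<delta>" "\<delta> < 1/2" "tube_direction \<delta> (brush_tube \<delta> c d) u"
  shows "norm u = 1 \<and> u $ 1 = c * u $ 3 \<and> u $ 2 = d * u $ 3"
proof -
  obtain x where u: "norm u = 1" and eq: "brush_tube \<delta> c d = cylinder \<delta> x u"
    using assms(3) unfolding tube_direction_def is_tube_def by auto
  have "u = sgn (vector [c, d, 1]) \<or> u = - sgn (vector [c, d, 1])"
    using cylinder_axis_unique[OF _ assms(2) norm_sgn_cd1 u] eq assms(1)
    unfolding brush_tube_def by auto
  then show ?thesis using u by (auto simp: sgn_div_norm)
qed

text \<open>The parameters are the quotients of the first two coordinates by the third. Their bounds
  keep the third coordinate at least 1/5 in absolute value, so a cross-multiplied difference of at
  most \<open>2 * dist u v\<close> is divided by at least 1/25.\<close>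

lemma direction_parameters_lipschitz:
  fixes u v :: "real^3"
  assumes u: "norm u = 1" "u $ 1 = c * u $ 3" "u $ 2 = d * u $ 3" "\<bar>c\<bar> \<le> 1" "\<bar>d\<bar> \<le> 4"
    and v: "norm v = 1" "v $ 1 = c' * v $ 3" "v $ 2 = d' * v $ 3" "\<bar>c'\<bar> \<le> 1" "\<bar>d'\<bar> \<le> 4"
  shows "\<bar>c - c'\<bar> \<le> 50 * dist u v" "\<bar>d - d'\<bar> \<le> 50 * dist u v"
proof -
  have third: "1/5 \<le> \<bar>w $ 3\<bar>"
    if "norm w = 1" "w $ 1 = a * w $ 3" "w $ 2 = b * w $ 3" "\<bar>a\<bar> \<le> 1" "\<bar>b\<bar> \<le> 4"
    for w :: "real^3" and a b
  proof -
    have "a\<^sup>2 \<le> 1" "b\<^sup>2 \<le> 16"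
      using abs_le_square_iff[of a 1] abs_le_square_iff[of b 4] that by auto
    moreover have "w \<bullet> w = 1" using that(1) by (simp add: norm_eq_1)
    then have "(w $ 3)\<^sup>2 * (a\<^sup>2 + b\<^sup>2 + 1) = 1"
      using that(2,3) by (simp add: inner_vec_def sum_3 power2_eq_square algebra_simps)
    \<comment> \<open>The sum is at most 1 + 16 + 1 = 18, rounded up to the square 25.\<close>
    moreover have "(w $ 3)\<^sup>2 * (a\<^sup>2 + b\<^sup>2 + 1) \<le> (w $ 3)\<^sup>2 * 25"
      using \<open>a\<^sup>2 \<le> 1\<close> \<open>b\<^sup>2 \<le> 16\<close> by (intro mult_left_mono) auto
    ultimately have "1 \<le> (w $ 3)\<^sup>2 * 25" by simp
    then have "(1/5)\<^sup>2 \<le> (w $ 3)\<^sup>2" by (simp add: power2_eq_square)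
    then show ?thesis using abs_le_square_iff[of "1/5" "w $ 3"] by simp
  qed
  have key: "\<bar>a - a'\<bar> \<le> 50 * dist u v"
    if "u $ i = a * u $ 3" "v $ i = a' * v $ 3" for i a a'
  proof -
    \<comment> \<open>The left side is \<open>u $ i * v $ 3 - u $ 3 * v $ i\<close>, split so that
      each term contains a coordinate of \<open>u - v\<close> up to sign.\<close>
    have "(a - a') * (u $ 3 * v $ 3) = u $ i * (v $ 3 - u $ 3) + u $ 3 * (u $ i - v $ i)"
      using that by (simp add: algebra_simps)
    then have "\<bar>a - a'\<bar> * (\<bar>u $ 3\<bar> * \<bar>v $ 3\<bar>)
        \<le> \<bar>u $ i\<bar> * \<bar>v $ 3 - u $ 3\<bar> + \<bar>u $ 3\<bar> * \<bar>u $ i - v $ i\<bar>"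
      using abs_triangle_ineq[of "u $ i * (v $ 3 - u $ 3)" "u $ 3 * (u $ i - v $ i)"]
      unfolding abs_mult[symmetric] by simp
    also have "\<dots> \<le> 1 * dist u v + 1 * dist u v"
    proof (intro add_mono mult_mono)
      show "\<bar>u $ i\<bar> \<le> 1" "\<bar>u $ 3\<bar> \<le> 1" using component_le_norm_cart[of u] u(1) by auto
      show "\<bar>v $ 3 - u $ 3\<bar> \<le> dist u v" "\<bar>u $ i - v $ i\<bar> \<le> dist u v"
        using component_le_norm_cart[of "u - v" 3] component_le_norm_cart[of "u - v" i]
        by (auto simp: dist_norm abs_minus_commute)
    qed auto
    finally have "\<bar>a - a'\<bar> * (\<bar>u $ 3\<bar> * \<bar>v $ 3\<bar>) \<le> 2 * dist u v" by simp
    moreover have "1/25 \<le> \<bar>u $ 3\<bar> * \<bar>v $ 3\<bar>"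
      using mult_mono[OF third[OF u] third[OF v]] by simp
    then have "\<bar>a - a'\<bar> * (1/25) \<le> \<bar>a - a'\<bar> * (\<bar>u $ 3\<bar> * \<bar>v $ 3\<bar>)"
      by (intro mult_left_mono) auto
    ultimately have "\<bar>a - a'\<bar> * (1/25) \<le> 2 * dist u v" by (blast intro: order_trans)
    then show ?thesis by simp
  qed
  show "\<bar>c - c'\<bar> \<le> 50 * dist u v" "\<bar>d - d'\<bar> \<le> 50 * dist u v"
    using key u(2,3) v(2,3) by blast+
qed

text \<open>Integer indices make distinct parameter pairs differ by at least \<open>h\<close> in one
  coordinate (for \<open>h > 0\<close>). The range of \<open>d\<close> avoids 0 and contains
  \<open>1/x\<close> for all \<open>x\<close> between 3/10 and 2/5.\<close>

definition grid :: "real \<Rightarrow> (int \<times> int) set" where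
  "grid h = {(i, j). \<bar>h * real_of_int i\<bar> \<le> 1 \<and> 2 \<le> h * real_of_int j \<and> h * real_of_int j \<le> 4}"

definition brush :: "real \<Rightarrow> int \<times> int \<Rightarrow> (real^3) set" where
  "brush \<delta> = (\<lambda>(i, j). brush_tube \<delta> (50 * \<delta> * real_of_int i) (50 * \<delta> * real_of_int j))"

text \<open>Distinct grid points differ by at least \<open>50 * \<delta>\<close> in one parameter,
  and 50 is the Lipschitz constant of the parameters. Since \<open>u\<close> and \<open>v\<close>
  are any directions of the tubes, both signs are covered.\<close>

lemma brush_separated:
  assumes \<delta>: "0 < \<delta>" "\<delta> < 1/2" and g: "a \<in> grid (50 * \<delta>)" "b \<in> grid (50 * \<delta>)" "a \<noteq> b"
    and dir: "tube_direction \<delta> (brush \<delta> a) u" "tube_direction \<delta> (brush \<delta> b) v"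
  shows "\<delta> \<le> dist u v"
proof (rule ccontr)
  assume "\<not> \<delta> \<le> dist u v"
  obtain i j i' j' where ab: "a = (i, j)" "b = (i', j')" by (metis surj_pair)
  have u: "norm u = 1 \<and> u $ 1 = (50 * \<delta> * real_of_int i) * u $ 3 \<and> u $ 2 = (50 * \<delta> * real_of_int j) * u $ 3"
    using brush_tube_direction[OF \<delta>] dir(1) ab by (simp add: brush_def)
  have v: "norm v = 1 \<and> v $ 1 = (50 * \<delta> * real_of_int i') * v $ 3 \<and> v $ 2 = (50 * \<delta> * real_of_int j') * v $ 3"
    using brush_tube_direction[OF \<delta>] dir(2) ab by (simp add: brush_def)
  have bd: "\<bar>50 * \<delta> * real_of_int i\<bar> \<le> 1" "\<bar>50 * \<delta> * real_of_int j\<bar> \<le> 4"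
    "\<bar>50 * \<delta> * real_of_int i'\<bar> \<le> 1" "\<bar>50 * \<delta> * real_of_int j'\<bar> \<le> 4"
    using g ab by (auto simp: grid_def)
  have lt: "50 * dist u v < 50 * \<delta>" using \<open>\<not> \<delta> \<le> dist u v\<close> by simp
  have int_eq: "m = n" if "\<bar>50 * \<delta> * real_of_int m - 50 * \<delta> * real_of_int n\<bar> \<le> 50 * dist u v" for m n
  proof -
    have "50 * \<delta> * \<bar>real_of_int m - real_of_int n\<bar> < 50 * \<delta> * 1"
    proof -
      have "50 * \<delta> * \<bar>real_of_int m - real_of_int n\<bar> =
          \<bar>50 * \<delta> * real_of_int m - 50 * \<delta> * real_of_int n\<bar>"
        using \<delta> by (simp add: abs_mult flip: right_diff_distrib)
      then show ?thesis using that lt by linarith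
    qed
    then have "\<bar>real_of_int m - real_of_int n\<bar> < 1"
      using mult_less_cancel_left_pos[of "50 * \<delta>" _ 1] \<delta>(1) by (simp only: mult_pos_pos zero_less_numeral)
    then show ?thesis by linarith
  qed
  note lip = direction_parameters_lipschitz[OF u[THEN conjunct1]
      u[THEN conjunct2, THEN conjunct1] u[THEN conjunct2, THEN conjunct2] bd(1,2)
      v[THEN conjunct1] v[THEN conjunct2, THEN conjunct1] v[THEN conjunct2, THEN conjunct2] bd(3,4)]
  have "i = i'" "j = j'" using int_eq[OF lip(1)] int_eq[OF lip(2)] .
  then show False using ab g by simp
qed

text \<open>The family is a set of tubes, so injectivity is what turns a count of grid points into a
  count of tubes. It follows from separation: a tube with two indices would have a direction at
  positive distance from itself.\<close>

lemma brush_family: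
  assumes \<delta>: "0 < \<delta>" "\<delta> < 1/2"
  shows "\<forall>T \<in> brush \<delta> ` grid (50 * \<delta>). SL2_tube \<delta> T"
    and "separated_directions \<delta> (brush \<delta> ` grid (50 * \<delta>))"
    and "inj_on (brush \<delta>) (grid (50 * \<delta>))"
proof -
  show tubes: "\<forall>T \<in> brush \<delta> ` grid (50 * \<delta>). SL2_tube \<delta> T"
    by (auto simp: brush_def grid_def intro!: SL2_tube_brush)
  show "separated_directions \<delta> (brush \<delta> ` grid (50 * \<delta>))"
    unfolding separated_directions_def using brush_separated[OF \<delta>] by blast
  show "inj_on (brush \<delta>) (grid (50 * \<delta>))"
  proof (rule inj_onI, rule ccontr)
    fix a b assume ab: "a \<in> grid (50 * \<delta>)" "b \<in> grid (50 * \<delta>)" "brush \<delta> a = brush \<delta> b" "a \<noteq> b"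
    obtain u where "tube_direction \<delta> (brush \<delta> a) u"
      using tubes ab(1) unfolding SL2_tube_def tube_direction_def by blast
    then have "\<delta> \<le> dist u u" using brush_separated[OF \<delta>] ab by metis
    then show False using \<delta> by simp
  qed
qed

section \<open>Multiplicity near the x-axis\<close>

text \<open>At height \<open>z\<close> the axis passes through
  \<open>(1/d + z * c, z * d, z)\<close>. The third coordinate agrees exactly, and the other two
  errors add up to at most \<delta>. The last hypothesis keeps the point within half a length of the
  centre.\<close>

lemma mem_brush_tube:
  assumes "\<bar>x - (1/d + z * c)\<bar> \<le> \<delta>/2" "\<bar>y - z * d\<bar> \<le> \<delta>/2" "\<bar>x - 1/d\<bar> + \<bar>y\<bar> + \<bar>z\<bar> \<le> 1/2"
  shows "vector [x, y, z] \<in> brush_tube \<delta> c d"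
proof -
  define V :: "real^3" where "V = vector [c, d, 1]"
  have V0: "norm V \<noteq> 0" using vector_cd1_nz by (simp add: V_def)
  have zV: "(z * norm V) *\<^sub>R sgn V = z *\<^sub>R V" using V0 by (simp add: sgn_div_norm)
  show ?thesis unfolding brush_tube_def
  proof (rule mem_cylinder_if_near_axis[OF norm_sgn_cd1, where t = "z * norm V"], fold V_def)
    show "norm (vector [x, y, z] - vector [1/d, 0, 0] :: real^3) \<le> 1/2"
      by (rule order_trans[OF norm_le_l1_cart]) (use assms in \<open>simp add: sum_3\<close>)
    show "dist (vector [x, y, z]) (vector [1/d, 0, 0] + (z * norm V) *\<^sub>R sgn V) \<le> \<delta>"
      unfolding zV dist_norm
      by (rule order_trans[OF norm_le_l1_cart]) (use assms in \<open>simp add: sum_3 V_def\<close>)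
  qed
qed

text \<open>The first multiple of \<open>h\<close> from \<open>a\<close> on overshoots by at most
  \<open>h\<close>, which leaves room for \<open>k - 1\<close> further steps.\<close>

lemma grid_points_in_interval:
  fixes h a :: real
  assumes "0 < h"
  shows "\<exists>J :: int set. finite J \<and> card J = k \<and>
    (\<forall>j\<in>J. a \<le> h * real_of_int j \<and> h * real_of_int j \<le> a + real k * h)"
proof -
  define j0 where "j0 = \<lceil>a / h\<rceil>"
  have "a / h \<le> real_of_int j0" "real_of_int j0 \<le> a / h + 1" unfolding j0_def by linarith+
  then have j0: "a \<le> h * real_of_int j0" "h * real_of_int j0 \<le> a + h"
    using assms by (auto simp: field_simps)
  have "a \<le> h * real_of_int j \<and> h * real_of_int j \<le> a + real k * h"
    if "j \<in> {j0..<j0 + int k}" for j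
  proof -
    have "real_of_int j0 \<le> real_of_int j" "real_of_int j \<le> real_of_int j0 + real k - 1"
      using that by auto
    then have "h * real_of_int j0 \<le> h * real_of_int j"
      "h * real_of_int j \<le> h * (real_of_int j0 + real k - 1)"
      using assms by simp_all
    then show ?thesis using j0 by (simp add: algebra_simps)
  qed
  then show ?thesis by (intro exI[of _ "{j0..<j0 + int k}"]) simp
qed

text \<open>A tube contains \<open>(x, y, z)\<close> if \<open>d\<close> is within \<open>r / 10\<close> of \<open>y / z\<close> and then \<open>c\<close> within \<open>r / 10\<close>
  of \<open>(x - 1/d) / z\<close>; the constant 500 makes these intervals hold exactly \<open>k\<close> grid steps.\<close>

lemma brush_multiplicity:
  fixes r x y z :: real
  assumes k: "0 < k" and r: "r = 1 / (500 * real k)" and \<delta>: "\<delta> = r\<^sup>2"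
    and x: "3/10 \<le> x" "x \<le> 2/5" and z: "r \<le> z" "z \<le> 2 * r" and y: "\<bar>y - z / x\<bar> \<le> \<delta> / 10"
  shows "real (k\<^sup>2) \<le> (\<Sum>T \<in> brush \<delta> ` grid (50 * \<delta>). indicator T (vector [x, y, z] :: real^3))"
proof -
  have r0: "0 < r" "r \<le> 1/500" using k by (auto simp: r)
  have rr: "\<delta> = r * r" by (simp add: \<delta> power2_eq_square)
  have \<delta>0: "0 < \<delta>" "\<delta> < 1/2"
    using r0 mult_mono[of r "1/500" r "1/500"] by (auto simp: rr)
  have kh: "real k * (50 * \<delta>) = r / 10" using k by (simp add: rr r)
  have h0: "0 < 50 * \<delta>" using \<delta>0 by simp
  obtain J where J: "finite J" "card J = k"
    "\<forall>j\<in>J. y / z \<le> 50 * \<delta> * real_of_int j \<and> 50 * \<delta> * real_of_int j \<le> y / z + r / 10"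
    using grid_points_in_interval[OF h0, of k "y / z", unfolded kh] by (elim exE conjE)
  \<comment> \<open>\<open>b j\<close> is the slope \<open>c\<close> whose line has first coordinate
    exactly \<open>x\<close> at height \<open>z\<close>. It depends on \<open>j\<close> because the
    base point \<open>1/d\<close> does, so the set of admissible \<open>i\<close> is chosen
    separately for each \<open>j\<close>.\<close>
  define b where "b j = (x - 1 / (50 * \<delta> * real_of_int j)) / z" for j
  have "\<forall>j. \<exists>I. finite I \<and> card I = k \<and>
      (\<forall>i\<in>I. b j \<le> 50 * \<delta> * real_of_int i \<and> 50 * \<delta> * real_of_int i \<le> b j + r / 10)"
    by (intro allI grid_points_in_interval[OF h0, of k, unfolded kh])
  from choice[OF this] obtain I where I: "\<forall>j. finite (I j) \<and> card (I j) = k \<and>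
      (\<forall>i\<in>I j. b j \<le> 50 * \<delta> * real_of_int i \<and> 50 * \<delta> * real_of_int i \<le> b j + r / 10)"
    by (elim exE)
  \<comment> \<open>The pairs are swapped: \<open>d\<close> is chosen before \<open>c\<close>, while
    \<open>grid\<close> lists the index of \<open>c\<close> first.\<close>
  define S where "S = (\<lambda>(j, i). (i, j)) ` (SIGMA j:J. I j)"
  have cS: "card S = k\<^sup>2"
  proof -
    have "card S = card (SIGMA j:J. I j)"
      unfolding S_def by (intro card_image) (auto simp: inj_on_def)
    then show ?thesis using J I by (simp add: power2_eq_square)
  qed
  have *: "(i, j) \<in> grid (50 * \<delta>) \<and> (vector [x, y, z] :: real^3) \<in> brush \<delta> (i, j)"
    if "j \<in> J" "i \<in> I j" for i j
  proof -
    define d where "d = 50 * \<delta> * real_of_int j"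
    define c where "c = 50 * \<delta> * real_of_int i"
    have z0: "0 < z" using r0 z by linarith
    have d: "y / z \<le> d" "d \<le> y / z + r / 10" using bspec[OF J(3) that(1)] by (auto simp: d_def)
    have c: "(x - 1 / d) / z \<le> c" "c \<le> (x - 1 / d) / z + r / 10"
      using I[rule_format, of j] that(2) by (auto simp: d_def c_def b_def)
    \<comment> \<open>Dividing the tolerance \<open>\<delta> / 10\<close> by
      \<open>z \<ge> r\<close> leaves \<open>r / 10\<close>, since
      \<open>\<delta> = r * r\<close>.\<close>
    have "\<bar>y / z - 1 / x\<bar> \<le> r / 10"
    proof -
      have "y / z - 1 / x = (y - z / x) / z" using z0 by (simp add: diff_divide_distrib)
      then have "\<bar>y / z - 1 / x\<bar> = \<bar>y - z / x\<bar> / z" using z0 by simp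
      also have "\<dots> \<le> (\<delta> / 10) / r" using y z z0 r0 \<delta>0 by (intro frac_le) auto
      also have "\<dots> = r / 10" using r0 by (simp add: rr)
      finally show ?thesis .
    qed
    then have dx: "\<bar>d - 1 / x\<bar> \<le> r / 5" using d by linarith
    have x': "5/2 \<le> 1 / x" "1 / x \<le> 10/3" using x by (auto simp: field_simps)
    have d24: "2 \<le> d" "d \<le> 4" using dx x' r0 by linarith+
    \<comment> \<open>Here the surface \<open>x y = z\<close> enters: a slope \<open>d\<close> near
      \<open>1/x\<close> puts the base point \<open>1/d\<close> within \<open>r / 10\<close> of
      \<open>x\<close>, so the slope \<open>c\<close> needed to reach \<open>x\<close> at height
      \<open>z \<ge> r\<close> stays bounded.\<close>
    have "\<bar>x - 1 / d\<bar> \<le> r / 10"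
    proof -
      have "x - 1 / d = (d - 1 / x) * (x / d)" using d24 x by (simp add: field_simps)
      then have "\<bar>x - 1 / d\<bar> = \<bar>d - 1 / x\<bar> * (x / d)" using d24 x by (simp add: abs_mult)
      also have "\<dots> \<le> (r / 5) * (1 / 2)"
        using dx d24 x r0 by (intro mult_mono) (auto simp: field_simps)
      finally show ?thesis by simp
    qed
    then have "\<bar>x - 1 / d\<bar> / z \<le> (r / 10) / r" using z r0 by (intro frac_le) auto
    then have "\<bar>(x - 1 / d) / z\<bar> \<le> 1 / 10" using r0 z0 by simp
    then have c1: "\<bar>c\<bar> \<le> 1" using c r0 by linarith
    \<comment> \<open>A slope error of \<open>r / 10\<close> displaces the line by at most
      \<open>z * (r / 10)\<close> at height \<open>z\<close>. Since \<open>z \<le> 2 * r\<close>,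
      this is at most \<open>\<delta> / 5\<close>.\<close>
    have zr: "z * (r / 10) \<le> \<delta> / 2"
      using mult_right_mono[OF z(2), of r] r0 by (simp add: rr)
    have "z * (y / z) \<le> z * d" "z * d \<le> z * (y / z + r / 10)"
      using mult_left_mono[OF d(1) less_imp_le[OF z0]] mult_left_mono[OF d(2) less_imp_le[OF z0]] .
    moreover have "z * (y / z) = y" "z * (y / z + r / 10) = y + z * (r / 10)"
      using z0 by (simp_all add: distrib_left)
    ultimately have yd: "\<bar>y - z * d\<bar> \<le> \<delta> / 2" using zr by linarith
    have "z * ((x - 1 / d) / z) \<le> z * c" "z * c \<le> z * ((x - 1 / d) / z + r / 10)"
      using mult_left_mono[OF c(1) less_imp_le[OF z0]] mult_left_mono[OF c(2) less_imp_le[OF z0]] .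
    moreover have "z * ((x - 1 / d) / z) = x - 1 / d"
      "z * ((x - 1 / d) / z + r / 10) = x - 1 / d + z * (r / 10)"
      using z0 by (simp_all add: distrib_left)
    ultimately have xc: "\<bar>x - (1 / d + z * c)\<bar> \<le> \<delta> / 2" using zr by linarith
    have "z * d \<le> (2 * r) * 4" "0 \<le> z * d"
      using mult_mono[OF z(2) d24(2)] z0 d24 r0 by simp_all
    moreover have "\<delta> \<le> r" using mult_left_mono[of r 1 r] r0 by (simp add: rr)
    ultimately have "\<bar>y\<bar> \<le> 9 * r" using yd by linarith
    moreover have "\<bar>z\<bar> \<le> 2 * r" using z z0 by simp
    ultimately have "\<bar>x - 1 / d\<bar> + \<bar>y\<bar> + \<bar>z\<bar> \<le> 1/2"
      using \<open>\<bar>x - 1 / d\<bar> \<le> r / 10\<close> r0(2) by linarith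
    from mem_brush_tube[OF xc yd this] show ?thesis
      using c1 d24 by (simp add: grid_def brush_def c_def d_def)
  qed
  let ?F = "brush \<delta> ` grid (50 * \<delta>)"
  \<comment> \<open>A sum over an infinite family would be 0 by default, so finiteness is needed to
    compare with the part indexed by \<open>S\<close>.\<close>
  have fin: "finite ?F"
    using finite_separated_SL2_tubes[OF \<delta>0(1)] brush_family[OF \<delta>0] by blast
  have S: "s \<in> grid (50 * \<delta>) \<and> (vector [x, y, z] :: real^3) \<in> brush \<delta> s" if s: "s \<in> S" for s
  proof -
    obtain i j where "s = (i, j)" "j \<in> J" "i \<in> I j" using s unfolding S_def by auto
    then show ?thesis using * by simp
  qed
  then have SG: "S \<subseteq> grid (50 * \<delta>)" by blast
  have "real (k\<^sup>2) = card (brush \<delta> ` S)"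
    using inj_on_subset[OF brush_family(3)[OF \<delta>0] SG] by (simp add: card_image cS)
  also have "\<dots> = (\<Sum>T \<in> brush \<delta> ` S. indicator T (vector [x, y, z] :: real^3))"
  proof -
    have "indicator T (vector [x, y, z] :: real^3) = (1::real)" if "T \<in> brush \<delta> ` S" for T
      using that S by auto
    then show ?thesis by simp
  qed
  also have "\<dots> \<le> (\<Sum>T \<in> ?F. indicator T (vector [x, y, z] :: real^3))"
    using SG fin by (intro sum_mono2) auto
  finally show ?thesis .
qed


section \<open>Disjoint boxes of high multiplicity\<close>

text \<open>The centres lie on the surface \<open>x y = z\<close>. The index shift \<open>Suc j\<close> keeps the boxes inside
  \<open>z \<ge> r\<close>.\<close>

definition box_centre :: "real \<Rightarrow> nat \<times> nat \<Rightarrow> real^3" where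
  "box_centre r = (\<lambda>(i, j). let x = 1/3 + real i * r\<^sup>2; z = r + real (Suc j) * r\<^sup>2 in vector [x, z / x, z])"

text \<open>Disjoint cubes stand in for a curved neighbourhood of the surface, so that its measure
  is found by counting. The half side is small against the spacing \<open>r^2\<close> of the centres
  and fits the tolerance \<open>r^2 / 10\<close> in \<open>brush_multiplicity\<close>.\<close>

definition small_box :: "real \<Rightarrow> nat \<times> nat \<Rightarrow> (real^3) set" where
  "small_box r a = cbox (box_centre r a - (\<chi> _. r\<^sup>2 / 100)) (box_centre r a + (\<chi> _. r\<^sup>2 / 100))"

lemma mem_small_box:
  "w \<in> small_box r a \<longleftrightarrow> (\<forall>m. \<bar>w $ m - box_centre r a $ m\<bar> \<le> r\<^sup>2 / 100)"
proof -
  have "(c - e \<le> t \<and> t \<le> c + e) \<longleftrightarrow> \<bar>t - c\<bar> \<le> e" for c e t :: real by linarith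
  then show ?thesis unfolding small_box_def mem_box_cart by simp
qed

lemma measure_small_box: "measure lebesgue (small_box r a) = (r\<^sup>2 / 50) ^ 3"
proof -
  \<comment> \<open>The product formula for the content requires a nonempty box.\<close>
  have "box_centre r a \<in> small_box r a" by (simp add: mem_small_box)
  then have "measure lborel (small_box r a) = (\<Prod>m\<in>(UNIV::3 set). r\<^sup>2 / 50)"
    unfolding small_box_def by (subst content_cbox_cart) auto
  then show ?thesis by (simp add: small_box_def)
qed

text \<open>Centres of intersecting boxes differ by at most \<open>r^2 / 50\<close> in each
  coordinate, whereas the first and third coordinates run through progressions of step
  \<open>r^2\<close> indexed by \<open>i\<close> and \<open>j\<close>.\<close>

lemma disjoint_small_boxes:
  assumes "0 < r"
  shows "disjoint_family_on (small_box r) I"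
proof (unfold disjoint_family_on_def, intro ballI impI, rule ccontr)
  fix a b assume "a \<noteq> b" "small_box r a \<inter> small_box r b \<noteq> {}"
  then obtain w where w: "w \<in> small_box r a" "w \<in> small_box r b" by blast
  obtain i j i' j' where ab: "a = (i, j)" "b = (i', j')" by (metis surj_pair)
  have cl: "\<bar>box_centre r a $ m - box_centre r b $ m\<bar> < r\<^sup>2" for m
    using w[unfolded mem_small_box, rule_format, of m] assms zero_less_power[of r 2] by linarith
  have eq: "m = n" if "\<bar>real m * r\<^sup>2 - real n * r\<^sup>2\<bar> < r\<^sup>2" for m n
  proof -
    have "\<bar>real m - real n\<bar> * r\<^sup>2 < 1 * r\<^sup>2"
      using that by (simp add: abs_mult flip: left_diff_distrib)
    then have "\<bar>real m - real n\<bar> < 1" using assms by (simp add: mult_less_cancel_right)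
    then show ?thesis by linarith
  qed
  have "i = i'" using cl[of 1] by (intro eq) (simp add: ab box_centre_def Let_def)
  moreover have "Suc j = Suc j'"
    using cl[of 3] by (intro eq) (simp add: ab box_centre_def Let_def del: of_nat_Suc)
  ultimately show False using ab \<open>a \<noteq> b\<close> by simp
qed

text \<open>Since \<open>k * r = 1/500\<close>, the index ranges keep \<open>x\<close> within
  1/250000 of 1/3 and \<open>z\<close> between \<open>r\<close> and \<open>r + r / 500\<close>, well
  inside the region where the multiplicity bound applies.\<close>

lemma small_box_in_brush:
  fixes r :: real
  assumes k: "0 < k" and r: "r = 1 / (500 * real k)" and ij: "i < k\<^sup>2" "j < k"
    and w: "w \<in> small_box r (i, j)"
  shows "w \<in> ball 0 1"
    and "real (k\<^sup>2) \<le> (\<Sum>T \<in> brush (r\<^sup>2) ` grid (50 * r\<^sup>2). indicator T w)"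
proof -
  have r0: "0 < r" "r \<le> 1/500" using k by (auto simp: r)
  define e where "e = r\<^sup>2 / 100"
  have e: "0 < e" "e \<le> r / 50000" using r0 by (auto simp: e_def power2_eq_square)
  define x z where "x = 1/3 + real i * r\<^sup>2" and "z = r + real (Suc j) * r\<^sup>2"
  define y where "y = z / x"
  have "real i * r\<^sup>2 \<le> (real k)\<^sup>2 * r\<^sup>2"
    using ij(1) by (intro mult_right_mono) (auto simp flip: of_nat_power)
  also have "\<dots> = 1 / 250000" using k by (simp add: r power2_eq_square)
  finally have x: "1/3 \<le> x" "x \<le> 1/3 + 1/250000" by (auto simp: x_def)
  have "real (Suc j) * r\<^sup>2 \<le> real k * r\<^sup>2" using ij(2) by (intro mult_right_mono) auto
  also have "\<dots> = r / 500" using k by (simp add: r power2_eq_square)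
  finally have "real (Suc j) * r\<^sup>2 \<le> r / 500" .
  moreover have "1 * r\<^sup>2 \<le> real (Suc j) * r\<^sup>2" by (intro mult_right_mono) auto
  ultimately have z: "r + 100 * e \<le> z" "z \<le> r + r / 500" by (auto simp: z_def e_def)
  have y: "0 \<le> y" "y \<le> 1/100"
    using x z r0 e by (auto simp: y_def field_simps)
  have w': "\<bar>w $ 1 - x\<bar> \<le> e" "\<bar>w $ 2 - y\<bar> \<le> e" "\<bar>w $ 3 - z\<bar> \<le> e"
    using w[unfolded mem_small_box, rule_format, of 1] w[unfolded mem_small_box, rule_format, of 2]
      w[unfolded mem_small_box, rule_format, of 3]
    by (simp_all add: box_centre_def Let_def x_def y_def z_def e_def)
  have w1: "3/10 \<le> w $ 1" "w $ 1 \<le> 2/5" using w'(1) x e(2) r0(2) by linarith+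
  have w3: "r \<le> w $ 3" "w $ 3 \<le> 2 * r" using w'(3) z e r0(1) by linarith+
  have "\<bar>w $ 2\<bar> \<le> 1/10" using w'(2) y e(2) r0(2) by linarith
  moreover have "\<bar>w $ 1\<bar> \<le> 2/5" using w1 by simp
  moreover have "\<bar>w $ 3\<bar> \<le> 1/10" using w3 r0 by simp
  moreover have "norm w \<le> \<bar>w $ 1\<bar> + \<bar>w $ 2\<bar> + \<bar>w $ 3\<bar>"
    using norm_le_l1_cart[of w] by (simp add: sum_3)
  ultimately have "norm w < 1" by linarith
  then show "w \<in> ball 0 1" by simp
  \<comment> \<open>Multiplying out uses \<open>y * x = z\<close> and leaves three terms of size at
    most \<open>e\<close>. Division by \<open>w $ 1 \<ge> 3/10\<close> then gives
    \<open>10 * e\<close>, exactly the tolerance \<open>r^2 / 10\<close>.\<close>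
  have "w $ 2 * w $ 1 - w $ 3 = (w $ 2 - y) * w $ 1 + y * (w $ 1 - x) + (z - w $ 3)"
    using x by (simp add: y_def algebra_simps)
  moreover have "\<bar>(w $ 2 - y) * w $ 1\<bar> \<le> e * 1"
    unfolding abs_mult using w' w1 e by (intro mult_mono) auto
  moreover have "\<bar>y * (w $ 1 - x)\<bar> \<le> 1 * e"
    unfolding abs_mult using w' y e by (intro mult_mono) auto
  ultimately have "\<bar>w $ 2 * w $ 1 - w $ 3\<bar> \<le> 3 * e" using w'(3) by linarith
  moreover have "\<bar>w $ 2 - w $ 3 / w $ 1\<bar> = \<bar>w $ 2 * w $ 1 - w $ 3\<bar> / w $ 1"
  proof -
    have "w $ 2 - w $ 3 / w $ 1 = (w $ 2 * w $ 1 - w $ 3) / w $ 1"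
      using w1 by (simp add: diff_divide_distrib)
    then show ?thesis using w1 by simp
  qed
  moreover have "\<bar>w $ 2 * w $ 1 - w $ 3\<bar> / w $ 1 \<le> (3 * e) / (3 / 10)"
    using calculation(1) w1 e(1) by (intro frac_le) simp_all
  ultimately have "\<bar>w $ 2 - w $ 3 / w $ 1\<bar> \<le> (3 * e) / (3 / 10)" by simp
  then have w2: "\<bar>w $ 2 - w $ 3 / w $ 1\<bar> \<le> r\<^sup>2 / 10" by (simp add: e_def)
  have "w = vector [w $ 1, w $ 2, w $ 3]" by (simp add: vec_eq_iff forall_3)
  then show "real (k\<^sup>2) \<le> (\<Sum>T \<in> brush (r\<^sup>2) ` grid (50 * r\<^sup>2). indicator T w)"
    using brush_multiplicity[OF k r refl w1 w3 w2] by simp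
qed

section \<open>Lower bound for the norm\<close>

text \<open>Chebyshev's inequality: \<open>M powr p\<close> on \<open>E\<close> is a minorant of the
  integrand. The bound \<open>K\<close> serves only to make the integrand integrable, since
  otherwise the Bochner integral would be 0.\<close>

lemma Lp_norm_ge:
  fixes f :: "'a::euclidean_space \<Rightarrow> real"
  assumes p: "1 \<le> p" and M: "0 \<le> M" and A: "A \<in> lmeasurable" and E: "E \<in> lmeasurable" "E \<subseteq> A"
    and f: "f \<in> borel_measurable lebesgue" "\<And>x. \<bar>f x\<bar> \<le> K" "\<And>x. x \<in> E \<Longrightarrow> M \<le> f x"
  shows "M powr p * measure lebesgue E \<le> Lp_norm p A f powr p"
proof -
  let ?g = "\<lambda>x. indicat_real A x *\<^sub>R \<bar>f x\<bar> powr p"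
  have "integrable lebesgue ?g"
  proof (rule Bochner_Integration.integrable_bound)
    show "integrable lebesgue (\<lambda>x. indicat_real A x * K powr p)"
      using A by (intro integrable_mult_left integrable_real_indicator) (auto simp: fmeasurable_def)
    show "?g \<in> borel_measurable lebesgue" using f(1) A by measurable
    show "AE x in lebesgue. norm (?g x) \<le> norm (indicat_real A x * K powr p)"
      using f(2) p by (intro AE_I2) (auto simp: indicator_def intro!: powr_mono2)
  qed
  moreover have "integrable lebesgue (\<lambda>x. indicat_real E x * M powr p)"
    using E by (intro integrable_mult_left integrable_real_indicator) (auto simp: fmeasurable_def)
  ultimately have "(LINT x|lebesgue. indicat_real E x * M powr p) \<le> (LINT x|lebesgue. ?g x)"
  proof (intro integral_mono)
    fix x
    show "indicat_real E x * M powr p \<le> ?g x"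
      using f(3)[of x] E(2) M p by (auto simp: indicator_def intro!: powr_mono2)
  qed
  moreover have "(LINT x|lebesgue. indicat_real E x * M powr p) = M powr p * measure lebesgue E"
    using E by (simp add: mult.commute)
  ultimately have "M powr p * measure lebesgue E \<le> (LINT x:A|lebesgue. \<bar>f x\<bar> powr p)"
    by (simp add: set_lebesgue_integral_def mult.commute)
  \<comment> \<open>Nonnegativity lets the outer power \<open>p\<close> cancel the
    \<open>1/p\<close> in \<open>Lp_norm\<close>.\<close>
  moreover have "0 \<le> (LINT x:A|lebesgue. \<bar>f x\<bar> powr p)"
    unfolding set_lebesgue_integral_def by (intro integral_nonneg_AE AE_I2) auto
  ultimately show ?thesis
    using p by (simp add: Lp_norm_def powr_powr)
qed

lemma closed_SL2_tube:
  assumes "SL2_tube \<delta> T"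
  shows "closed T"
  using assms unfolding SL2_tube_def is_tube_def by (elim exE conjE) (simp add: closed_cylinder)

text \<open>Multiplicity \<open>k^2\<close> holds on \<open>k^3\<close> disjoint boxes of volume
  \<open>(r^2 / 50)^3\<close>. As \<open>r = 1 / (500 * k)\<close>, the power of \<open>k\<close> is
  \<open>2 * p + 3 - 6\<close>.\<close>

lemma brush_Lp_norm:
  fixes r p :: real
  assumes p: "1 \<le> p" and k: "0 < k" and r: "r = 1 / (500 * real k)"
  shows "real k powr (2 * p - 3) / 50 ^ 3 / 500 ^ 6
    \<le> Lp_norm p (ball 0 1) (\<lambda>x. \<Sum>T \<in> brush (r\<^sup>2) ` grid (50 * r\<^sup>2). indicator T x) powr p"
proof -
  have r0: "0 < r" "r \<le> 1/500" using k by (auto simp: r)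
  have \<delta>: "0 < r\<^sup>2" "r\<^sup>2 < 1/2"
    using r0 mult_mono[of r "1/500" r "1/500"] by (auto simp: power2_eq_square)
  let ?F = "brush (r\<^sup>2) ` grid (50 * r\<^sup>2)"
  have fin: "finite ?F"
    using finite_separated_SL2_tubes[OF \<delta>(1)] brush_family[OF \<delta>] by blast
  define I where "I = {..<k\<^sup>2} \<times> {..<k}"
  define E where "E = \<Union> (small_box r ` I)"
  have finI: "finite I" "card I = k ^ 3" by (auto simp: I_def power2_eq_square power3_eq_cube)
  have E: "E \<in> lmeasurable"
    unfolding E_def using finI by (intro fmeasurable.finite_Union) (auto simp: small_box_def)
  have "measure lebesgue E = (\<Sum>a\<in>I. measure lebesgue (small_box r a))"
    unfolding E_def
    by (intro measure_finite_Union finI disjoint_small_boxes r0)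
      (auto simp: small_box_def emeasure_lborel_cbox_eq)
  also have "\<dots> = real k ^ 3 * (r\<^sup>2 / 50) ^ 3" by (simp add: measure_small_box finI)
  also have "\<dots> = real k powr (- 3) / 50 ^ 3 / 500 ^ 6"
  proof -
    have pk: "real k powr (- 3) = 1 / real k ^ 3" by (simp add: powr_minus divide_inverse)
    show ?thesis
      unfolding pk using k by (simp add: r power_divide power_mult_distrib field_simps flip: power_mult power_add)
  qed
  finally have mE: "measure lebesgue E = real k powr (- 3) / 50 ^ 3 / 500 ^ 6" .
  have "real (k\<^sup>2) powr p * measure lebesgue E
      \<le> Lp_norm p (ball 0 1) (\<lambda>x. \<Sum>T \<in> ?F. indicator T x) powr p"
  proof (rule Lp_norm_ge[OF p])
    show "E \<subseteq> ball 0 1" "\<And>x. x \<in> E \<Longrightarrow> real (k\<^sup>2) \<le> (\<Sum>T \<in> ?F. indicator T x)"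
      using small_box_in_brush[OF k r] by (auto simp: E_def I_def simp del: mem_ball mem_ball_0)
    show "(\<lambda>x. \<Sum>T \<in> ?F. indicator T x :: real) \<in> borel_measurable lebesgue"
    proof (rule borel_measurable_sum)
      fix T assume "T \<in> ?F"
      then have "closed T" using brush_family(1)[OF \<delta>] closed_SL2_tube by blast
      then show "indicat_real T \<in> borel_measurable lebesgue" by (intro borel_measurable_indicator) auto
    qed
    show "\<bar>\<Sum>T \<in> ?F. indicator T x\<bar> \<le> real (card ?F)" for x
    proof -
      have "(\<Sum>T \<in> ?F. indicat_real T x) \<le> (\<Sum>T \<in> ?F. 1)"
        by (intro sum_mono) (auto simp: indicator_def)
      then show ?thesis by (simp add: sum_nonneg)
    qed
  qed (use E in auto)
  moreover have "real (k\<^sup>2) powr p = real k powr (2 * p)"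
    using k by (simp add: powr_powr flip: powr_numeral)
  moreover have "real k powr (2 * p - 3) = real k powr (2 * p) * real k powr (- 3)"
    by (simp flip: powr_add)
  ultimately show ?thesis unfolding mE by simp
qed

section \<open>Comparison of exponents as \<open>k\<close> grows\<close>

theorem proposition3p7:
  fixes p :: real
  assumes "1 \<le> p"
    and "\<forall>\<epsilon>>0. \<exists>C::real. \<forall>\<delta> \<T>. 0 < \<delta> \<longrightarrow> \<delta> < 1 \<longrightarrow>
           (\<forall>T\<in>\<T>. SL2_tube \<delta> T) \<longrightarrow> separated_directions \<delta> \<T> \<longrightarrow>
           (Lp_norm p (ball 0 1) (\<lambda>x. \<Sum>T\<in>\<T>. indicator T x)) powr p \<le> C * \<delta> powr (- \<epsilon>)"
  shows "p \<le> 3/2"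
proof (rule ccontr)
  assume "\<not> p \<le> 3/2"
  \<comment> \<open>With \<open>\<delta> = r^2\<close> the assumed bound grows like
    \<open>k powr (2 * \<epsilon>)\<close>. This choice makes the lower bound grow like
    \<open>k powr (4 * \<epsilon>)\<close>, so a factor \<open>k powr (2 * \<epsilon>)\<close>
    remains.\<close>
  define \<epsilon> where "\<epsilon> = (2 * p - 3) / 4"
  have \<epsilon>: "0 < \<epsilon>" using \<open>\<not> p \<le> 3/2\<close> by (simp add: \<epsilon>_def)
  then obtain C where C: "\<And>\<delta> \<T>. 0 < \<delta> \<Longrightarrow> \<delta> < 1 \<Longrightarrow>
      (\<forall>T\<in>\<T>. SL2_tube \<delta> T) \<Longrightarrow> separated_directions \<delta> \<T> \<Longrightarrow>
      (Lp_norm p (ball 0 1) (\<lambda>x. \<Sum>T\<in>\<T>. indicator T x)) powr p \<le> C * \<delta> powr (- \<epsilon>)"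
    using assms(2) by blast
  define D where "D = C * 500 powr (2 * \<epsilon>) * 500 ^ 6 * 50 ^ 3"
  have bound: "real k powr (2 * \<epsilon>) \<le> D" if k: "0 < k" for k
  proof -
    define r where "r = 1 / (500 * real k)"
    have r0: "0 < r" "r \<le> 1/500" using k by (auto simp: r_def)
    have \<delta>: "0 < r\<^sup>2" "r\<^sup>2 < 1/2"
      using r0 mult_mono[of r "1/500" r "1/500"] by (auto simp: power2_eq_square)
    have "real k powr (2 * p - 3) / 50 ^ 3 / 500 ^ 6 \<le> C * (r\<^sup>2) powr (- \<epsilon>)"
      using brush_Lp_norm[OF assms(1) k r_def] C[OF \<delta>(1) _ brush_family(1,2)[OF \<delta>]] \<delta>(2)
      by (force intro: order_trans)
    also have "(r\<^sup>2) powr (- \<epsilon>) = 500 powr (2 * \<epsilon>) * real k powr (2 * \<epsilon>)"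
    proof -
      have "(r\<^sup>2) powr (- \<epsilon>) = r powr (- (2 * \<epsilon>))"
        using r0 by (simp add: powr_powr flip: powr_numeral)
      also have "\<dots> = (500 * real k) powr (2 * \<epsilon>)"
        using k by (simp add: r_def powr_minus powr_divide)
      finally show ?thesis by (simp add: powr_mult)
    qed
    finally have "real k powr (2 * p - 3) \<le> D * real k powr (2 * \<epsilon>)"
      by (simp add: D_def field_simps)
    moreover have "real k powr (2 * p - 3) = real k powr (2 * \<epsilon>) * real k powr (2 * \<epsilon>)"
      unfolding powr_add[symmetric] by (rule arg_cong[where f = "(powr) (real k)"]) (simp add: \<epsilon>_def)
    ultimately show ?thesis using k by simp
  qed
  \<comment> \<open>The sign of \<open>D\<close> is not known at this point; \<open>max 1 D\<close>
    gives a positive base, so that the powers cancel.\<close>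
  obtain k where k: "max 1 D powr (1 / (2 * \<epsilon>)) < real k" using reals_Archimedean2 by blast
  have "max 1 D = (max 1 D powr (1 / (2 * \<epsilon>))) powr (2 * \<epsilon>)"
    using \<epsilon> by (simp add: powr_powr)
  also have "\<dots> < real k powr (2 * \<epsilon>)" using k \<epsilon> by (intro powr_less_mono2) auto
  also have "\<dots> \<le> D" using k by (intro bound) (metis gr0I not_less of_nat_0 powr_ge_zero)
  finally show False by simp
qed

end
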